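(* Let $\mathtt{k}>0$, $\nu>-\mathtt{k}$ and $c\in\mathbb{R}$. Then the function $y(x)=\mathtt{W}^{\mathtt{k}}_{\nu,c}(x)$ is, for $x>0$, a solution of the homogeneous differential equation $$\frac{d^2y}{dx^2}+x^{-1}\frac{dy}{dx}+\frac{1}{\mathtt{k}^2}\left(c\,\mathtt{k}-\frac{\nu^2}{x^2}\right)y=0.$$
   Context: For $\mathtt{k}>0$, the $\mathtt{k}$-gamma function is $\Gamma_{\mathtt{k}}(z)=\int_0^\infty t^{z-1}e^{-t^{\mathtt{k}}/\mathtt{k}}\,dt$ for $\operatorname{Re}(z)>0$; it satisfies $\Gamma_{\mathtt{k}}(z+\mathtt{k})=z\,\Gamma_{\mathtt{k}}(z)$. The generalized $\mathtt{k}$-Bessel function of order $\nu$ is defined for $x>0$ by $$\mathtt{W}^{\mathtt{k}}_{\nu,c}(x)=\sum_{r=0}^\infty\frac{(-c)^r}{\Gamma_{\mathtt{k}}(r\mathtt{k}+\nu+\mathtt{k})\,r!}\left(\frac{x}{2}\right)^{2r+\frac{\nu}{\mathtt{k}}}.$$ Here $(-c)^0=1$, also when $c=0$. *)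

theory Defs
  imports "HOL-Analysis.Analysis"
begin

text \<open>
  The \<open>k\<close>-gamma function. Like \<^const>\<open>Gamma\<close> it is stated for a generic field type, so that the
  one definition gives both the function of a complex argument and its restriction to real
  arguments, which is the one occurring in the Bessel series below.
  It is meaningful for \<open>k > 0\<close> and \<open>Re z > 0\<close>, where the integral converges absolutely.
\<close>

definition k_Gamma :: "real \<Rightarrow> 'a \<Rightarrow> 'a :: {real_normed_field, ln, second_countable_topology}" where
  "k_Gamma k z =
     (LINT t:{0<..}|lborel. of_real t powr (z - 1) * of_real (exp (- (t powr k) / k)))"

text \<open>
  Meaningful for \<open>k > 0\<close>, \<open>\<nu> > - k\<close> and \<open>x > 0\<close>. The \<open>r\<close>-th power of \<open>- c\<close> has a natural number
  as exponent, so it is \<open>1\<close> for \<open>r = 0\<close> even if \<open>c = 0\<close>.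
\<close>

definition k_Bessel :: "real \<Rightarrow> real \<Rightarrow> real \<Rightarrow> real \<Rightarrow> real" where
  "k_Bessel k \<nu> c x =
     (\<Sum>r. (- c) ^ r / (k_Gamma k (real r * k + \<nu> + k) * fact r) * (x / 2) powr (2 * real r + \<nu> / k))"

end

theory Submission
  imports Defs
begin

text \<open>
  The substitution \<open>t = (k u) powr (1 / k)\<close> turns the integral of the \<open>k\<close>-gamma function into
  Euler's integral, so that \<open>k_Gamma k z = k powr (z / k - 1) * Gamma (z / k)\<close> for real \<open>z > 0\<close>
  (lemma \<open>k_Gamma_conv_Gamma\<close>). Hence the \<open>k\<close>-Bessel function is a classical Bessel-type function
  in disguise: with \<open>p = \<nu> / k > - 1\<close> and \<open>a = c / k\<close>,
  \<open>k_Bessel k \<nu> c x = C * x powr p * F (x\<^sup>2 / 4)\<close>, where \<open>C\<close> does not depend on \<open>x\<close> and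
  \<open>F t = (\<Sum>r. b r * t ^ r)\<close> with \<open>b r = (- a) ^ r / (Gamma (r + p + 1) * fact r)\<close>
  (lemma \<open>k_Bessel_conv_power_series\<close>).

  The functional equation of \<open>Gamma\<close> makes the coefficients satisfy
  \<open>(r + 1) * (r + p + 1) * b (r + 1) = - a * b r\<close>. By the ratio test \<open>F\<close> is entire, so it may be
  differentiated term by term, and comparing coefficients the recurrence says exactly that
  \<open>t * F'' t + (p + 1) * F' t + a * F t = 0\<close> (lemma \<open>bessel_power_series_ode\<close>).
  The chain rule applied to \<open>y x = C * x powr p * F (x\<^sup>2 / 4)\<close> gives
  \<open>y'' + y' / x - (p\<^sup>2 / x\<^sup>2) * y = C * x powr p * (t * F'' t + (p + 1) * F' t)\<close> at \<open>t = x\<^sup>2 / 4\<close>,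
  and the right-hand side is \<open>- a * y\<close>. As \<open>a = c * k / k\<^sup>2\<close> and \<open>p\<^sup>2 = \<nu>\<^sup>2 / k\<^sup>2\<close>, this is the
  claimed equation.
\<close>

section \<open>The k-gamma function in terms of the gamma function\<close>

text \<open>
  Euler's integral as a Lebesgue integral: since the integrand is nonnegative, integrability
  comes for free from the value of the corresponding \<open>nn_integral\<close>.
\<close>

lemma has_bochner_integral_Gamma_real:
  fixes a :: real
  assumes "a > 0"
  shows "has_bochner_integral lborel (\<lambda>t. indicator {0<..} t *\<^sub>R (t powr (a - 1) * exp (- t))) (Gamma a)"
proof -
  have "has_bochner_integral lborel (\<lambda>t. indicator {0..} t * t powr (a - 1) / exp t) (Gamma a)"
    using assms by (intro has_bochner_integral_nn_integral) (auto simp: Gamma_conv_nn_integral_real Gamma_real_nonneg)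
  also have "(\<lambda>t. indicator {0..} t * t powr (a - 1) / exp t)
      = (\<lambda>t. indicator {0<..} t *\<^sub>R (t powr (a - 1) * exp (- t)))"
    by (auto simp: fun_eq_iff indicator_def exp_minus field_simps)
  finally show ?thesis .
qed

text \<open>
  The substitution has to be made from Euler's integral towards the \<open>k\<close>-gamma integral, because
  the substitution rule asks for integrability of the substituted integrand, and this is known
  for the former. In terms of \<open>z\<close>, the powers of \<open>k u\<close> combine to the exponent
  \<open>(z - 1) / k + (1 / k - 1) = z / k - 1\<close>.
\<close>
lemma k_Gamma_conv_Gamma:
  fixes k z :: real
  assumes k: "k > 0" and z: "z > 0"
  shows "k_Gamma k z = k powr (z / k - 1) * Gamma (z / k)"
proof -
  define f where "f = (\<lambda>t::real. t powr (z - 1) * exp (- (t powr k) / k))"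
  define g where "g = (\<lambda>u::real. (k * u) powr (1 / k))"
  define g' where "g' = (\<lambda>u::real. (k * u) powr (1 / k - 1))"
  define h where "h = (\<lambda>u::real. k powr (z / k - 1) * (u powr (z / k - 1) * exp (- u)))"
  have fg: "f (g u) * g' u = h u" if "u > 0" for u
  proof -
    have "f (g u) * g' u = (k * u) powr (1 / k * (z - 1) + (1 / k - 1)) * exp (- u)"
      using that k by (simp add: f_def g_def g'_def powr_powr powr_add)
    also have "1 / k * (z - 1) + (1 / k - 1) = z / k - 1"
      using k by (simp add: field_simps)
    finally show ?thesis
      using that k by (simp add: h_def powr_mult)
  qed
  have h: "has_bochner_integral lborel (\<lambda>u. indicator {0<..} u *\<^sub>R h u)
      (k powr (z / k - 1) * Gamma (z / k))"
    using has_bochner_integral_mult_right[OF has_bochner_integral_Gamma_real[of "z / k"], of "k powr (z / k - 1)"]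
      k z by (simp add: h_def mult_ac)
  also have "(\<lambda>u. indicator {0<..} u *\<^sub>R h u) = (\<lambda>u. indicator {0<..} u *\<^sub>R (f (g u) * g' u))"
    using fg by (auto simp: fun_eq_iff indicator_def)
  finally have fg_int: "has_bochner_integral lborel (\<lambda>u. indicator {0<..} u *\<^sub>R (f (g u) * g' u))
      (k powr (z / k - 1) * Gamma (z / k))" .
  have E: "einterval 0 \<infinity> = {0<..}"
    by (auto simp: einterval_def)
  have "(LBINT x=0..\<infinity>. f x) = (LBINT x=0..\<infinity>. f (g x) * g' x)"
  proof (rule interval_integral_substitution_nonneg(2))
    show "DERIV g x :> g' x" if "0 < ereal x" for x
      unfolding g_def g'_def using that k
      by (auto intro!: derivative_eq_intros simp: powr_diff)
    show "isCont f (g x)" if "0 < ereal x" for x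
    proof -
      have "g x > 0" using that k by (simp add: g_def)
      then show ?thesis using k unfolding f_def by (intro continuous_intros) auto
    qed
    show "isCont g' x" if "0 < ereal x" for x
      unfolding g'_def using that k by (intro continuous_intros) auto
    show "((ereal \<circ> g \<circ> real_of_ereal) \<longlongrightarrow> 0) (at_right 0)"
    proof -
      have "(g \<longlongrightarrow> (k * 0) powr (1 / k)) (at_right 0)"
        unfolding g_def using k
        by (intro tendsto_powr' tendsto_intros) (auto simp: eventually_at_filter)
      then show ?thesis
        by (auto simp: zero_ereal_def ereal_tendsto_simps)
    qed
    show "((ereal \<circ> g \<circ> real_of_ereal) \<longlongrightarrow> \<infinity>) (at_left \<infinity>)"
    proof -
      have "filterlim (\<lambda>u. exp (1 / k * ln (k * u))) at_top at_top"
        using k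
        by (intro filterlim_compose[OF exp_at_top] filterlim_compose[OF ln_at_top]
            filterlim_tendsto_pos_mult_at_top[OF tendsto_const] filterlim_ident) auto
      moreover have "\<forall>\<^sub>F u in at_top. exp (1 / k * ln (k * u)) = (k * u) powr (1 / k)"
        using eventually_gt_at_top[of 0] by eventually_elim (use k in \<open>simp add: powr_def\<close>)
      ultimately have "filterlim (\<lambda>u. (k * u) powr (1 / k)) at_top at_top"
        by (rule filterlim_cong[OF refl refl, THEN iffD1, rotated])
      then show ?thesis
        by (auto simp: ereal_tendsto_simps g_def tendsto_PInfty_eq_at_top)
    qed
    show "set_integrable lborel (einterval 0 \<infinity>) (\<lambda>x. f (g x) * g' x)"
      using fg_int by (simp add: E set_integrable_def has_bochner_integral_iff)
  qed (auto simp: f_def g'_def)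
  also have "\<dots> = k powr (z / k - 1) * Gamma (z / k)"
    using fg_int by (simp add: interval_lebesgue_integral_0_infty set_lebesgue_integral_def
        has_bochner_integral_iff)
  finally show ?thesis
    by (simp add: k_Gamma_def f_def interval_lebesgue_integral_0_infty)
qed

section \<open>The underlying entire function\<close>

definition bessel_coeff :: "real \<Rightarrow> real \<Rightarrow> nat \<Rightarrow> real" where
  "bessel_coeff a p r = (- a) ^ r / (Gamma (real r + p + 1) * fact r)"

lemma bessel_coeff_Suc:
  assumes "p > -1"
  shows "(real r + 1) * (real r + p + 1) * bessel_coeff a p (Suc r) = - a * bessel_coeff a p r"
proof -
  have pos: "real r + p + 1 > 0" using assms by linarith
  then have "Gamma (real r + p + 1 + 1) = (real r + p + 1) * Gamma (real r + p + 1)"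
    by (intro Gamma_plus1) (auto elim!: nonpos_Ints_cases)
  then have "bessel_coeff a p (Suc r)
      = (- a) ^ Suc r / (((real r + p + 1) * Gamma (real r + p + 1)) * ((real r + 1) * fact r))"
    by (simp add: bessel_coeff_def add_ac)
  then have "bessel_coeff a p (Suc r) = - a * bessel_coeff a p r / ((real r + 1) * (real r + p + 1))"
    by (simp add: bessel_coeff_def mult_ac)
  then show ?thesis
    using pos by simp
qed

text \<open>
  By the recurrence, consecutive terms have the ratio \<open>- a * t / ((r + 1) * (r + p + 1))\<close>, which
  tends to zero for every \<open>t\<close>.
\<close>
lemma summable_bessel_coeff:
  assumes p: "p > -1"
  shows "summable (\<lambda>r. bessel_coeff a p r * t ^ r)"
proof -
  \<comment> \<open>From \<open>N\<close> on, the denominator of the ratio is at least twice the numerator.\<close>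
  obtain N :: nat where N: "real N > 2 * \<bar>a * t\<bar> + \<bar>p\<bar>"
    using reals_Archimedean2 by blast
  show ?thesis
  proof (rule summable_ratio_test[of "1/2" N])
    fix r assume "r \<ge> N"
    then have r: "real r + p + 1 \<ge> 2 * \<bar>a * t\<bar>" "real r + p + 1 > 0"
      using N p by auto
    define D where "D = (real r + 1) * (real r + p + 1)"
    have "1 * (real r + p + 1) \<le> D"
      unfolding D_def using r by (intro mult_right_mono) auto
    then have D: "D > 0" "D \<ge> 2 * \<bar>a * t\<bar>"
      using r by auto
    have "bessel_coeff a p (Suc r) = - a / D * bessel_coeff a p r"
      using bessel_coeff_Suc[OF p, of r a] D(1)
      unfolding D_def[symmetric] by (simp add: field_simps)
    then have "norm (bessel_coeff a p (Suc r) * t ^ Suc r)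
        = \<bar>a * t\<bar> / D * norm (bessel_coeff a p r * t ^ r)"
      using D(1) by (simp add: abs_mult)
    also have "\<dots> \<le> 1/2 * norm (bessel_coeff a p r * t ^ r)"
      using D by (intro mult_right_mono) (auto simp: divide_simps)
    finally show "norm (bessel_coeff a p (Suc r) * t ^ Suc r)
        \<le> 1/2 * norm (bessel_coeff a p r * t ^ r)" .
  qed auto
qed

text \<open>
  The coefficient of \<open>t ^ r\<close> on the left-hand side is
  \<open>(r * (r + 1) + (p + 1) * (r + 1)) * b (r + 1) + a * b r\<close>, which vanishes by the recurrence.
\<close>
lemma bessel_power_series_ode:
  fixes a p t :: real
  assumes p: "p > -1"
  defines "b \<equiv> bessel_coeff a p"
  shows "t * (\<Sum>r. diffs (diffs b) r * t ^ r) + (p + 1) * (\<Sum>r. diffs b r * t ^ r)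
           + a * (\<Sum>r. b r * t ^ r) = 0"
proof -
  have b: "summable (\<lambda>r. b r * s ^ r)" for s
    unfolding b_def by (rule summable_bessel_coeff[OF p])
  note b' = termdiff_converges_all[of b, OF b]
  note b'' = termdiff_converges_all[of "diffs b", OF b']
  \<comment> \<open>Multiplying \<open>F'' t\<close> by \<open>t\<close> repairs the index shift of the second derivative: its
      coefficients then refer to \<open>diffs b\<close> at the same index as those of \<open>F' t\<close>.\<close>
  have "(\<lambda>r. real r * diffs b r * t ^ (r - Suc 0)) sums (\<Sum>r. diffs (diffs b) r * t ^ r)"
    using diffs_equiv[OF b''] by simp
  from sums_mult[OF this, of t]
  have "(\<lambda>r. real r * diffs b r * t ^ r) sums (t * (\<Sum>r. diffs (diffs b) r * t ^ r))"
  proof (rule sums_cong[THEN iffD1, rotated])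
    show "t * (real r * diffs b r * t ^ (r - Suc 0)) = real r * diffs b r * t ^ r" for r
      by (cases r) auto
  qed
  moreover have "(\<lambda>r. (p + 1) * (diffs b r * t ^ r)) sums ((p + 1) * (\<Sum>r. diffs b r * t ^ r))"
    by (intro sums_mult summable_sums b')
  moreover have "(\<lambda>r. a * (b r * t ^ r)) sums (a * (\<Sum>r. b r * t ^ r))"
    by (intro sums_mult summable_sums b)
  ultimately have "(\<lambda>r. real r * diffs b r * t ^ r + (p + 1) * (diffs b r * t ^ r) + a * (b r * t ^ r))
     sums (t * (\<Sum>r. diffs (diffs b) r * t ^ r) + (p + 1) * (\<Sum>r. diffs b r * t ^ r)
           + a * (\<Sum>r. b r * t ^ r))"
    by (intro sums_add)
  also have "(\<lambda>r. real r * diffs b r * t ^ r + (p + 1) * (diffs b r * t ^ r) + a * (b r * t ^ r)) = (\<lambda>r. 0)"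
  proof
    fix r
    have "real r * diffs b r * t ^ r + (p + 1) * (diffs b r * t ^ r) + a * (b r * t ^ r)
      = ((real r + 1) * (real r + p + 1) * b (Suc r) + a * b r) * t ^ r"
      by (simp add: diffs_def algebra_simps)
    also have "\<dots> = 0"
      using bessel_coeff_Suc[OF p, of r a] by (simp add: b_def)
    finally show "real r * diffs b r * t ^ r + (p + 1) * (diffs b r * t ^ r) + a * (b r * t ^ r) = 0" .
  qed
  finally show ?thesis
    by (rule sums_unique2[OF _ sums_zero])
qed

section \<open>The k-Bessel function\<close>

text \<open>
  The \<open>r\<close>-th \<open>k\<close>-gamma value contributes \<open>k ^ r * k powr (\<nu> / k)\<close>: the first factor turns \<open>c\<close> into
  \<open>c / k\<close>, the second one leaves the sum together with the powers of \<open>x\<close> and \<open>2\<close> whose exponent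
  does not depend on \<open>r\<close>.
\<close>
lemma k_Bessel_conv_power_series:
  assumes k: "k > 0" and \<nu>: "\<nu> > - k" and x: "x > 0"
  shows "k_Bessel k \<nu> c x = (2 * k) powr (- \<nu> / k) * x powr (\<nu> / k)
           * (\<Sum>r. bessel_coeff (c / k) (\<nu> / k) r * (x\<^sup>2 / 4) ^ r)"
proof -
  have p: "\<nu> / k > -1" using k \<nu> by (simp add: field_simps)
  have "(- c) ^ r / (k_Gamma k (real r * k + \<nu> + k) * fact r) * (x / 2) powr (2 * real r + \<nu> / k)
     = (2 * k) powr (- \<nu> / k) * x powr (\<nu> / k) * (bessel_coeff (c / k) (\<nu> / k) r * (x\<^sup>2 / 4) ^ r)" for r
  proof -
    have "real r * k + \<nu> + k > 0"
      using k \<nu> by (simp add: add_nonneg_pos add.assoc)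
    moreover have "(real r * k + \<nu> + k) / k = real r + \<nu> / k + 1"
      using k by (simp add: field_simps)
    ultimately have "k_Gamma k (real r * k + \<nu> + k)
        = k powr (real r + \<nu> / k) * Gamma (real r + \<nu> / k + 1)"
      using k_Gamma_conv_Gamma[OF k] by simp
    also have "k powr (real r + \<nu> / k) = k ^ r * k powr (\<nu> / k)"
      using k by (simp add: powr_add powr_realpow)
    finally have G: "k_Gamma k (real r * k + \<nu> + k)
        = k ^ r * k powr (\<nu> / k) * Gamma (real r + \<nu> / k + 1)" .
    have X: "(x / 2) powr (2 * real r + \<nu> / k) = (x\<^sup>2 / 4) ^ r * (x powr (\<nu> / k) / 2 powr (\<nu> / k))"
    proof -
      have "(x / 2) powr (2 * real r) = (x / 2) ^ (2 * r)"
        using x by (subst powr_realpow[symmetric]) auto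
      then show ?thesis
        using x by (simp add: powr_add powr_divide power_mult power_divide)
    qed
    have K: "(2 * k) powr (- \<nu> / k) = 1 / (2 powr (\<nu> / k) * k powr (\<nu> / k))"
      using k by (simp add: powr_minus_divide powr_mult)
    have C: "(- (c / k)) ^ r = (- c) ^ r / k ^ r"
      by (metis minus_divide_left power_divide)
    show ?thesis
      unfolding G X K bessel_coeff_def C by (simp add: mult_ac)
  qed
  then show ?thesis
    unfolding k_Bessel_def
    using suminf_mult[OF summable_bessel_coeff[OF p]] by simp
qed

theorem proposition2p1:
  fixes k \<nu> c :: real and y :: "real \<Rightarrow> real"
  assumes "k > 0" and "\<nu> > - k"
    and y: "y = k_Bessel k \<nu> c"
  shows "\<forall>x>0. y differentiable (at x) \<and> deriv y differentiable (at x) \<and>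
           deriv (deriv y) x + inverse x * deriv y x
             + 1 / k\<^sup>2 * (c * k - \<nu>\<^sup>2 / x\<^sup>2) * y x = 0"
proof -
  define p a C where "p = \<nu> / k" and "a = c / k" and "C = (2 * k) powr (- \<nu> / k)"
  have p: "p > -1"
    using assms by (simp add: p_def field_simps)
  define b where "b = bessel_coeff a p"
  define F F' F'' where "F = (\<lambda>t. \<Sum>r. b r * t ^ r)" and "F' = (\<lambda>t. \<Sum>r. diffs b r * t ^ r)"
    and "F'' = (\<lambda>t. \<Sum>r. diffs (diffs b) r * t ^ r)"
  have b: "summable (\<lambda>r. b r * s ^ r)" for s
    unfolding b_def by (rule summable_bessel_coeff[OF p])
  have F: "(F has_field_derivative F' t) (at t)" for t
    unfolding F_def F'_def by (rule termdiffs_strong_converges_everywhere[OF b])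
  have F': "(F' has_field_derivative F'' t) (at t)" for t
    unfolding F'_def F''_def
    by (rule termdiffs_strong_converges_everywhere[OF termdiff_converges_all[OF b]])
  have F_ode: "t * F'' t + (p + 1) * F' t + a * F t = 0" for t
    unfolding F_def F'_def F''_def b_def by (rule bessel_power_series_ode[OF p])
  have y_eq: "y x = C * x powr p * F (x\<^sup>2 / 4)" if "x > 0" for x
    using k_Bessel_conv_power_series[OF assms(1,2) that, of c]
    by (simp add: y C_def p_def a_def b_def F_def)
  \<comment> \<open>The first two derivatives of \<open>C * x powr p * F (x\<^sup>2 / 4)\<close>. The formula for \<open>y\<close> holds for
      positive arguments only, but these form an open set, so it may be differentiated there.\<close>
  define y1 where "y1 = (\<lambda>x. C * x powr p * (p / x * F (x\<^sup>2 / 4) + x / 2 * F' (x\<^sup>2 / 4)))"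
  define y2 where "y2 = (\<lambda>x. C * x powr p * ((p\<^sup>2 - p) / x\<^sup>2 * F (x\<^sup>2 / 4)
      + (p + 1/2) * F' (x\<^sup>2 / 4) + x\<^sup>2 / 4 * F'' (x\<^sup>2 / 4)))"
  have y1: "(y has_field_derivative y1 x) (at x)" if "x > 0" for x
  proof (rule has_field_derivative_transform_within_open[where S = "{0<..}"])
    show "((\<lambda>x. C * x powr p * F (x\<^sup>2 / 4)) has_field_derivative y1 x) (at x)"
      using that unfolding y1_def
      by (auto intro!: derivative_eq_intros DERIV_chain2[OF F] simp: powr_diff field_simps)
  qed (use that y_eq in auto)
  then have deriv_y: "deriv y x = y1 x" if "x > 0" for x
    using that DERIV_imp_deriv by blast
  have y2: "(deriv y has_field_derivative y2 x) (at x)" if "x > 0" for x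
  proof (rule has_field_derivative_transform_within_open[where S = "{0<..}"])
    have P: "((\<lambda>x. x powr p) has_field_derivative p / x * x powr p) (at x)"
      using that by (auto intro!: derivative_eq_intros simp: powr_diff)
    have A: "((\<lambda>x. F (x\<^sup>2 / 4)) has_field_derivative F' (x\<^sup>2 / 4) * (x / 2)) (at x)"
      by (rule DERIV_chain2[OF F]) (auto intro!: derivative_eq_intros)
    have B: "((\<lambda>x. F' (x\<^sup>2 / 4)) has_field_derivative F'' (x\<^sup>2 / 4) * (x / 2)) (at x)"
      by (rule DERIV_chain2[OF F']) (auto intro!: derivative_eq_intros)
    have Q: "((\<lambda>x. p / x) has_field_derivative - p / x\<^sup>2) (at x)"
      using that by (auto intro!: derivative_eq_intros simp: power2_eq_square)
    have R: "((\<lambda>x. x / 2) has_field_derivative 1 / 2) (at x)"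
      by (auto intro!: derivative_eq_intros)
    show "(y1 has_field_derivative y2 x) (at x)"
      unfolding y1_def
      by (rule DERIV_cong[OF DERIV_mult[OF DERIV_cmult[OF P] DERIV_add[OF DERIV_mult[OF Q A] DERIV_mult[OF R B]]]])
        (use that in \<open>simp add: y2_def field_simps power2_eq_square\<close>)
  qed (use that deriv_y in auto)
  have "y2 x + inverse x * y1 x + 1 / k\<^sup>2 * (c * k - \<nu>\<^sup>2 / x\<^sup>2) * y x = 0" if "x > 0" for x
  proof -
    have coeff: "1 / k\<^sup>2 * (c * k - \<nu>\<^sup>2 / x\<^sup>2) = a - p\<^sup>2 / x\<^sup>2"
      using \<open>k > 0\<close> that by (simp add: a_def p_def field_simps power2_eq_square)
    have "y2 x + inverse x * y1 x + 1 / k\<^sup>2 * (c * k - \<nu>\<^sup>2 / x\<^sup>2) * y x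
        = C * x powr p * (x\<^sup>2 / 4 * F'' (x\<^sup>2 / 4) + (p + 1) * F' (x\<^sup>2 / 4) + a * F (x\<^sup>2 / 4))"
      unfolding coeff using that by (simp add: y_eq y1_def y2_def field_simps power2_eq_square)
    then show ?thesis
      using F_ode[of "x\<^sup>2 / 4"] by simp
  qed
  moreover have "deriv (deriv y) x = y2 x" if "x > 0" for x
    by (rule DERIV_imp_deriv[OF y2[OF that]])
  moreover have "y differentiable (at x)" "deriv y differentiable (at x)" if "x > 0" for x
    using y1[OF that] y2[OF that] real_differentiable_def by blast+
  ultimately show ?thesis
    using deriv_y by simp
qed

end
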